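(* The set of bi-infinite Bratteli diagrams $\mathcal{B}\in\beth$ whose positive part is minimal (that is, transitive and without periodic components) and uniquely ergodic is residual in $\beth$.
   Context: A Bratteli diagram $B=(V,E)$ is an infinite directed graph (multiple edges allowed) with $V=\bigsqcup_{k\ge 0}V_k$, $E=\bigsqcup_{k\ge1}E_k$, all $V_k,E_k$ finite and nonempty, and maps $r,s:E\to V$ with $r(E_k)=V_k$, $s(E_k)=V_{k-1}$. It is encoded by matrices $F_k$ of size $|V_k|\times|V_{k-1}|$ whose $(v,w)$ entry is the number of $e\in E_k$ with $r(e)=v$, $s(e)=w$ (so no zero rows or columns). $X_B$ is the space of infinite paths $(e_1,e_2,\dots)$, $e_i\in E_i$, $r(e_i)=s(e_{i+1})$, with the topology generated by the cylinder sets $C(e_1,\dots,e_n)$ of paths starting with $e_1,\dots,e_n$. Two paths are tail equivalent if they agree at all sufficiently large indices; $[\bar e]$ is the tail equivalence class of $\bar e$. A periodic component is a finite tail equivalence class. $B$ is transitive if there is a path $\bar e\in X_B$ with $\overline{[\bar e]}=X_B$; it is minimal if it is transitive and there is no periodic component. A Borel probability measure on $X_B$ is invariant if $C(e_1,\dots,e_n)$ and $C(f_1,\dots,f_n)$ have equal measure whenever $r(e_n)=r(f_n)$. $B$ is uniquely ergodic if it has exactly one invariant Borel probability measure. A bi-infinite Bratteli diagram $\mathcal{B}=(\mathcal{V},\mathcal{E})$ has $\mathcal{V}=\bigsqcup_{k\in\mathbb{Z}}\mathcal{V}_k$, $\mathcal{E}=\bigsqcup_{k\in\mathbb{Z}\setminus\{0\}}\mathcal{E}_k$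 (finite nonempty levels) with $s(\mathcal{E}_k)=\mathcal{V}_{k-1}$, $r(\mathcal{E}_k)=\mathcal{V}_k$ for $k>0$ and $s(\mathcal{E}_k)=\mathcal{V}_k$, $r(\mathcal{E}_k)=\mathcal{V}_{k+1}$ for $k<0$; its transition matrices $\mathcal{F}_k$, $k\neq0$, count the edges of $\mathcal{E}_k$ (rows indexed by ranges, columns by sources). The positive part is the Bratteli diagram on levels $k\ge0$. $\beth$ is the set of all bi-infinite Bratteli diagrams, identified with the composable sequences $(\dots,\mathcal{F}_{-2},\mathcal{F}_{-1},\mathcal{F}_1,\mathcal{F}_2,\dots)$ of non-negative integer matrices, with the topology generated by cylinder sets (finitely many matrices prescribed). A set is residual if it contains a countable intersection of dense open sets. *)

theory Defs
  imports "HOL-Probability.Probability_Measure" "Jordan_Normal_Form.Matrix"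
begin

(* Edge levels are shifted by one: edges B k is the set E_{k+1} of edges from V_k to V_{k+1}.
   Accordingly x k denotes the edge e_{k+1} of a path x = (e_1, e_2, ...). *)
record ('v, 'e) bratteli =
  verts :: "nat \<Rightarrow> 'v set"
  edges :: "nat \<Rightarrow> 'e set"
  rng :: "'e \<Rightarrow> 'v"
  src :: "'e \<Rightarrow> 'v"

definition bratteli_diagram :: "('v, 'e) bratteli \<Rightarrow> bool" where
  "bratteli_diagram B \<longleftrightarrow>
     disjoint_family (verts B) \<and> disjoint_family (edges B) \<and>
     (\<forall>k. finite (verts B k) \<and> verts B k \<noteq> {}) \<and>
     (\<forall>k. finite (edges B k) \<and> edges B k \<noteq> {}) \<and>
     (\<forall>k. rng B ` edges B k = verts B (Suc k) \<and> src B ` edges B k = verts B k)"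

definition paths :: "('v, 'e) bratteli \<Rightarrow> (nat \<Rightarrow> 'e) set" where
  "paths B = {x. \<forall>k. x k \<in> edges B k \<and> rng B (x k) = src B (x (Suc k))}"

definition finite_paths :: "('v, 'e) bratteli \<Rightarrow> 'e list set" where
  "finite_paths B = {es. es \<noteq> [] \<and> (\<forall>i<length es. es ! i \<in> edges B i) \<and>
     (\<forall>i. Suc i < length es \<longrightarrow> rng B (es ! i) = src B (es ! Suc i))}"

definition path_cylinder :: "('v, 'e) bratteli \<Rightarrow> 'e list \<Rightarrow> (nat \<Rightarrow> 'e) set" where
  "path_cylinder B es = {x \<in> paths B. \<forall>i<length es. x i = es ! i}"

definition path_topology :: "('v, 'e) bratteli \<Rightarrow> (nat \<Rightarrow> 'e) topology" where
  "path_topology B = topology_generated_by (path_cylinder B ` finite_paths B)"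

lemma topspace_path_topology: "topspace (path_topology B) = paths B"
proof -
  have "x \<in> path_cylinder B [x 0] \<and> [x 0] \<in> finite_paths B" if "x \<in> paths B" for x
    using that by (auto simp: paths_def path_cylinder_def finite_paths_def)
  then have "\<Union>(path_cylinder B ` finite_paths B) = paths B"
    by (force simp: path_cylinder_def)
  then show ?thesis
    by (simp add: path_topology_def)
qed

definition tail_class :: "('v, 'e) bratteli \<Rightarrow> (nat \<Rightarrow> 'e) \<Rightarrow> (nat \<Rightarrow> 'e) set" where
  "tail_class B x = {y \<in> paths B. \<exists>N. \<forall>n\<ge>N. y n = x n}"

definition periodic_component :: "('v, 'e) bratteli \<Rightarrow> (nat \<Rightarrow> 'e) set \<Rightarrow> bool" where
  "periodic_component B P \<longleftrightarrow> (\<exists>x\<in>paths B. P = tail_class B x) \<and> finite P"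

definition transitive :: "('v, 'e) bratteli \<Rightarrow> bool" where
  "transitive B \<longleftrightarrow> (\<exists>x\<in>paths B. path_topology B closure_of tail_class B x = paths B)"

definition minimal :: "('v, 'e) bratteli \<Rightarrow> bool" where
  "minimal B \<longleftrightarrow> transitive B \<and> \<not> (\<exists>P. periodic_component B P)"

definition borel_prob_measure :: "('v, 'e) bratteli \<Rightarrow> (nat \<Rightarrow> 'e) measure \<Rightarrow> bool" where
  "borel_prob_measure B M \<longleftrightarrow> prob_space M \<and> space M = paths B \<and>
     sets M = sigma_sets (paths B) {U. openin (path_topology B) U}"

definition invariant :: "('v, 'e) bratteli \<Rightarrow> (nat \<Rightarrow> 'e) measure \<Rightarrow> bool" where
  "invariant B M \<longleftrightarrow>
     (\<forall>es\<in>finite_paths B. \<forall>fs\<in>finite_paths B.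
        length es = length fs \<and> rng B (last es) = rng B (last fs) \<longrightarrow>
        measure M (path_cylinder B es) = measure M (path_cylinder B fs))"

definition uniquely_ergodic :: "('v, 'e) bratteli \<Rightarrow> bool" where
  "uniquely_ergodic B \<longleftrightarrow> (\<exists>!M. borel_prob_measure B M \<and> invariant B M)"

definition transition_matrix :: "nat mat \<Rightarrow> bool" where
  "transition_matrix A \<longleftrightarrow> dim_row A > 0 \<and> dim_col A > 0 \<and>
     (\<forall>v<dim_row A. \<exists>w<dim_col A. A $$ (v, w) \<noteq> 0) \<and>
     (\<forall>w<dim_col A. \<exists>v<dim_row A. A $$ (v, w) \<noteq> 0)"

(* The Bratteli diagram encoded by the matrices G k = F_{k+1}: (k, w) is the w-th vertex of
   level k, and (k, v, w, i) is the i-th edge from (k, w) to (k + 1, v). *)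
definition diagram_of ::
  "(nat \<Rightarrow> nat mat) \<Rightarrow> (nat \<times> nat, nat \<times> nat \<times> nat \<times> nat) bratteli" where
  "diagram_of G =
     \<lparr>verts = (\<lambda>k. {(k, w) | w. w < dim_col (G k)}),
      edges = (\<lambda>k. {(k, v, w, i) | v w i.
                 v < dim_row (G k) \<and> w < dim_col (G k) \<and> i < G k $$ (v, w)}),
      rng = (\<lambda>(k, v, w, i). (Suc k, v)),
      src = (\<lambda>(k, v, w, i). (k, w))\<rparr>"

lemma bratteli_diagram_diagram_of:
  assumes "\<And>k. transition_matrix (G k)" "\<And>k. dim_row (G k) = dim_col (G (Suc k))"
  shows "bratteli_diagram (diagram_of G)"
proof -
  have fin: "finite (edges (diagram_of G) k)" for k
  proof -
    have "edges (diagram_of G) k = (\<lambda>((v, w), i). (k, v, w, i)) `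
        (SIGMA p:{..<dim_row (G k)} \<times> {..<dim_col (G k)}. {..<G k $$ p})"
      by (auto simp: diagram_of_def image_iff)
    then show ?thesis
      by simp
  qed
  have rng: "rng (diagram_of G) ` edges (diagram_of G) k = verts (diagram_of G) (Suc k)" for k
  proof -
    have "(Suc k, v) \<in> rng (diagram_of G) ` edges (diagram_of G) k"
      if v: "v < dim_row (G k)" for v
    proof -
      obtain w where "w < dim_col (G k)" "G k $$ (v, w) \<noteq> 0"
        using assms(1)[of k] v by (auto simp: transition_matrix_def)
      with v show ?thesis
        by (intro image_eqI[of _ _ "(k, v, w, 0)"]) (auto simp: diagram_of_def)
    qed
    then show ?thesis
      using assms(2)[of k] by (fastforce simp: diagram_of_def)
  qed
  have src: "src (diagram_of G) ` edges (diagram_of G) k = verts (diagram_of G) k" for k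
  proof -
    have "(k, w) \<in> src (diagram_of G) ` edges (diagram_of G) k"
      if w: "w < dim_col (G k)" for w
    proof -
      obtain v where "v < dim_row (G k)" "G k $$ (v, w) \<noteq> 0"
        using assms(1)[of k] w by (auto simp: transition_matrix_def)
      with w show ?thesis
        by (intro image_eqI[of _ _ "(k, v, w, 0)"]) (auto simp: diagram_of_def)
    qed
    then show ?thesis
      by (fastforce simp: diagram_of_def)
  qed
  have ne: "verts (diagram_of G) k \<noteq> {}" for k
    using assms(1)[of k] by (auto simp: transition_matrix_def diagram_of_def)
  have "edges (diagram_of G) k \<noteq> {}" for k
    using ne[of k] src[of k] by auto
  moreover have "disjoint_family (verts (diagram_of G))" "disjoint_family (edges (diagram_of G))"
    by (auto simp: disjoint_family_on_def diagram_of_def)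
  moreover have "finite (verts (diagram_of G) k)" for k
    by (auto simp: diagram_of_def)
  ultimately show ?thesis
    using fin rng src ne by (auto simp: bratteli_diagram_def)
qed

lemma card_edges_diagram_of:
  assumes "v < dim_row (G k)" "w < dim_col (G k)"
  shows "card {e \<in> edges (diagram_of G) k.
      rng (diagram_of G) e = (Suc k, v) \<and> src (diagram_of G) e = (k, w)} = G k $$ (v, w)"
proof -
  have "{e \<in> edges (diagram_of G) k.
      rng (diagram_of G) e = (Suc k, v) \<and> src (diagram_of G) e = (k, w)} =
      (\<lambda>i. (k, v, w, i)) ` {..<G k $$ (v, w)}"
    using assms by (auto simp: diagram_of_def)
  then show ?thesis
    by (simp add: card_image inj_on_def)
qed

(* Bi-infinite Bratteli diagrams, as composable sequences indexed by the nonzero integers;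
   the value at the unused index 0 is fixed by extensionality. Both F_{-1} (rows) and
   F_1 (columns) are adjacent to level 0. *)
definition beth :: "(int \<Rightarrow> nat mat) set" where
  "beth = {F \<in> extensional (- {0}).
     (\<forall>k. k \<noteq> 0 \<longrightarrow> transition_matrix (F k)) \<and>
     (\<forall>k. k \<noteq> 0 \<and> k \<noteq> - 1 \<longrightarrow> dim_row (F k) = dim_col (F (k + 1))) \<and>
     dim_row (F (- 1)) = dim_col (F 1)}"

definition beth_cylinder :: "int set \<Rightarrow> (int \<Rightarrow> nat mat) \<Rightarrow> (int \<Rightarrow> nat mat) set" where
  "beth_cylinder I A = {F \<in> beth. \<forall>k\<in>I. F k = A k}"

definition beth_topology :: "(int \<Rightarrow> nat mat) topology" where
  "beth_topology = topology_generated_by {beth_cylinder I A | I A. finite I \<and> 0 \<notin> I}"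

lemma topspace_beth_topology: "topspace beth_topology = beth"
proof -
  have "beth = beth_cylinder {} A" for A
    by (simp add: beth_cylinder_def)
  then have "beth \<in> {beth_cylinder I A | I A. finite I \<and> 0 \<notin> I}"
    by blast
  moreover have "beth_cylinder I A \<subseteq> beth" for I A
    by (auto simp: beth_cylinder_def)
  ultimately have "\<Union>{beth_cylinder I A | I A. finite I \<and> 0 \<notin> I} = beth"
    by blast
  then show ?thesis
    by (simp add: beth_topology_def)
qed

definition positive_part ::
  "(int \<Rightarrow> nat mat) \<Rightarrow> (nat \<times> nat, nat \<times> nat \<times> nat \<times> nat) bratteli" where
  "positive_part F = diagram_of (\<lambda>k. F (int k + 1))"

lemma bratteli_diagram_positive_part:
  assumes "F \<in> beth"
  shows "bratteli_diagram (positive_part F)"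
  unfolding positive_part_def
proof (rule bratteli_diagram_diagram_of)
  fix k
  show "transition_matrix (F (int k + 1))"
    using assms by (simp add: beth_def)
  have "int k + 1 \<noteq> 0 \<and> int k + 1 \<noteq> - 1"
    by simp
  then have "dim_row (F (int k + 1)) = dim_col (F (int k + 1 + 1))"
    using assms unfolding beth_def by blast
  then show "dim_row (F (int k + 1)) = dim_col (F (int (Suc k) + 1))"
    by (simp add: ac_simps)
qed

(* The intersection with topspace X accounts for the empty family. *)
definition residual_in :: "'a topology \<Rightarrow> 'a set \<Rightarrow> bool" where
  "residual_in X S \<longleftrightarrow> S \<subseteq> topspace X \<and>
     (\<exists>\<U>. countable \<U> \<and> (\<forall>U\<in>\<U>. openin X U \<and> X closure_of U = topspace X) \<and>
          topspace X \<inter> \<Inter>\<U> \<subseteq> S)"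

end

theory Submission
  imports Defs "HOL-Probability.Infinite_Product_Measure"
begin

text \<open>
  The generic matrix sequence contains the \<open>1 \<times> 1\<close> matrix with entry \<open>2\<close> at infinitely many positive
  places: ``this matrix occurs at some place beyond \<open>n\<close>'' is an open condition, and a dense one, because
  any finite window can be prolonged by a matrix with a single row, followed by that matrix.

  For such a sequence the positive part has infinitely many levels with only one vertex
  (bottlenecks), and this decides everything. At a bottleneck any path can be continued by the tail
  of any other path, so every tail equivalence class is dense. The two parallel edges give each path
  infinitely many independent chances to be altered at a single place, so no class is finite.
  All initial segments ending at a given bottleneck have the same range, so an invariant
  probability measure gives equal mass to their cylinders; these masses are therefore determined, and
  they determine the measure (\<open>invariant_measure_unique\<close>). Conversely a path is
  the same thing as an arbitrary choice of one segment between each bottleneck and the next, that is,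
  the path space is a product of finite sets, and the product of the uniform measures is invariant
  (\<open>invariant_measure_exists\<close>).
\<close>

section \<open>Initial cylinders of a Bratteli diagram\<close>

definition initial_cylinder :: "('v, 'e) bratteli \<Rightarrow> (nat \<Rightarrow> 'e) \<Rightarrow> nat \<Rightarrow> (nat \<Rightarrow> 'e) set" where
  "initial_cylinder B x n = {y \<in> paths B. \<forall>i<n. y i = x i}"

definition splice :: "nat \<Rightarrow> (nat \<Rightarrow> 'e) \<Rightarrow> (nat \<Rightarrow> 'e) \<Rightarrow> nat \<Rightarrow> 'e" where
  "splice n x y = (\<lambda>i. if i < n then x i else y i)"

definition initial_segment :: "nat \<Rightarrow> (nat \<Rightarrow> 'e) \<Rightarrow> nat \<Rightarrow> 'e" where
  "initial_segment n x = restrict x {..<n}"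

lemma initial_segment_eq_iff: "initial_segment n x = initial_segment n y \<longleftrightarrow> (\<forall>i<n. x i = y i)"
  by (auto simp: initial_segment_def restrict_def fun_eq_iff)

lemma initial_cylinder_eq_segment:
  "initial_cylinder B x n = {y \<in> paths B. initial_segment n y = initial_segment n x}"
  by (simp add: initial_cylinder_def initial_segment_eq_iff)

lemma initial_cylinder_self: "x \<in> paths B \<Longrightarrow> x \<in> initial_cylinder B x n"
  by (simp add: initial_cylinder_def)

lemma initial_cylinder_subset_paths: "initial_cylinder B x n \<subseteq> paths B"
  by (auto simp: initial_cylinder_def)

lemma initial_cylinder_0 [simp]: "initial_cylinder B x 0 = paths B"
  by (simp add: initial_cylinder_def)

lemma initial_cylinder_cong: "y \<in> initial_cylinder B x n \<Longrightarrow> initial_cylinder B y n = initial_cylinder B x n"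
  by (auto simp: initial_cylinder_def)

lemma initial_cylinder_antimono: "n \<le> m \<Longrightarrow> initial_cylinder B x m \<subseteq> initial_cylinder B x n"
  by (auto simp: initial_cylinder_def)

lemma splice_in_paths:
  assumes "x \<in> paths B" "y \<in> paths B" "\<And>k. n = Suc k \<Longrightarrow> rng B (x k) = src B (y n)"
  shows "splice n x y \<in> paths B"
proof -
  have "splice n x y k \<in> edges B k \<and> rng B (splice n x y k) = src B (splice n x y (Suc k))" for k
    using assms by (cases "Suc k = n") (auto simp: paths_def splice_def)
  then show ?thesis
    by (simp add: paths_def)
qed

locale bratteli_diagram_locale =
  fixes B :: "('v, 'e) bratteli"
  assumes diagram: "bratteli_diagram B"
begin

lemma finite_edges: "finite (edges B k)"
  using diagram by (simp add: bratteli_diagram_def)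

lemma rng_in_verts: "e \<in> edges B k \<Longrightarrow> rng B e \<in> verts B (Suc k)"
  using diagram unfolding bratteli_diagram_def by blast

lemma next_edge_exists:
  assumes "e \<in> edges B k"
  shows "\<exists>e'\<in>edges B (Suc k). rng B e = src B e'"
proof -
  have "rng B e \<in> src B ` edges B (Suc k)"
    using rng_in_verts[OF assms] diagram by (simp add: bratteli_diagram_def)
  then show ?thesis by blast
qed

lemma path_edge: "x \<in> paths B \<Longrightarrow> x k \<in> edges B k"
  by (simp add: paths_def)

lemma path_composable: "x \<in> paths B \<Longrightarrow> rng B (x k) = src B (x (Suc k))"
  by (simp add: paths_def)

text \<open>Every vertex emits an edge, so no finite path is a dead end.\<close>

lemma finite_path_extends:
  assumes es: "es \<in> finite_paths B"
  shows "\<exists>x\<in>paths B. \<forall>i<length es. x i = es ! i"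
proof -
  have "\<exists>x. \<forall>n. (x n \<in> edges B n \<and> (n < length es \<longrightarrow> x n = es ! n)) \<and> rng B (x n) = src B (x (Suc n))"
  proof (rule dependent_nat_choice)
    show "\<exists>e. e \<in> edges B 0 \<and> (0 < length es \<longrightarrow> e = es ! 0)"
      using es by (auto simp: finite_paths_def)
  next
    fix e n assume e: "e \<in> edges B n \<and> (n < length es \<longrightarrow> e = es ! n)"
    show "\<exists>e'. (e' \<in> edges B (Suc n) \<and> (Suc n < length es \<longrightarrow> e' = es ! Suc n)) \<and> rng B e = src B e'"
    proof (cases "Suc n < length es")
      case True
      then show ?thesis using e es by (intro exI[of _ "es ! Suc n"]) (auto simp: finite_paths_def)
    next
      case False
      then show ?thesis using e next_edge_exists by blast
    qed
  qed
  then show ?thesis by (auto simp: paths_def)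
qed

lemma paths_nonempty: "paths B \<noteq> {}"
proof -
  have "edges B 0 \<noteq> {}"
    using diagram by (simp add: bratteli_diagram_def)
  then obtain e where "e \<in> edges B 0" by blast
  then have "[e] \<in> finite_paths B" by (simp add: finite_paths_def)
  then show ?thesis using finite_path_extends by blast
qed

lemma initial_list_in_finite_paths: "x \<in> paths B \<Longrightarrow> n > 0 \<Longrightarrow> map x [0..<n] \<in> finite_paths B"
  by (auto simp: paths_def finite_paths_def)

lemma path_cylinder_initial_list: "path_cylinder B (map x [0..<n]) = initial_cylinder B x n"
  by (auto simp: path_cylinder_def initial_cylinder_def)

lemma path_cylinder_eq_initial_cylinder:
  assumes "es \<in> finite_paths B"
  obtains x where "x \<in> paths B" "\<forall>i<length es. x i = es ! i"
    "path_cylinder B es = initial_cylinder B x (length es)"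
proof -
  obtain x where x: "x \<in> paths B" "\<forall>i<length es. x i = es ! i"
    using finite_path_extends[OF assms] by blast
  then have "path_cylinder B es = initial_cylinder B x (length es)"
    by (simp add: path_cylinder_def initial_cylinder_def)
  then show thesis
    using that x by blast
qed

lemma openin_path_topology_iff:
  "openin (path_topology B) U \<longleftrightarrow>
     U \<subseteq> paths B \<and> (\<forall>x\<in>U. \<exists>n. initial_cylinder B x n \<subseteq> U)"
proof
  assume U: "openin (path_topology B) U"
  then have "generate_topology_on (path_cylinder B ` finite_paths B) U"
    by (simp add: path_topology_def openin_topology_generated_by)
  then have "\<forall>x\<in>U. \<exists>n. initial_cylinder B x n \<subseteq> U"
  proof induction
    case Empty
    then show ?case by simp
  next
    case (Int a b)
    show ?case
    proof
      fix x assume "x \<in> a \<inter> b"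
      with Int obtain n m where "initial_cylinder B x n \<subseteq> a" "initial_cylinder B x m \<subseteq> b" by blast
      then have "initial_cylinder B x (max n m) \<subseteq> a \<inter> b"
        using initial_cylinder_antimono[of n "max n m" B x] initial_cylinder_antimono[of m "max n m" B x]
        by auto
      then show "\<exists>n. initial_cylinder B x n \<subseteq> a \<inter> b" ..
    qed
  next
    case (UN K)
    then show ?case by (meson Union_iff Sup_upper subset_trans)
  next
    case (Basis s)
    then obtain es where "s = path_cylinder B es" by blast
    then have "\<forall>x\<in>s. initial_cylinder B x (length es) \<subseteq> s"
      by (auto simp: path_cylinder_def initial_cylinder_def)
    then show ?case by blast
  qed
  then show "U \<subseteq> paths B \<and> (\<forall>x\<in>U. \<exists>n. initial_cylinder B x n \<subseteq> U)"
    using openin_subset[OF U] by (simp add: topspace_path_topology)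
next
  assume U: "U \<subseteq> paths B \<and> (\<forall>x\<in>U. \<exists>n. initial_cylinder B x n \<subseteq> U)"
  show "openin (path_topology B) U"
  proof (subst openin_subopen, intro ballI)
    fix x assume "x \<in> U"
    with U obtain n where n: "initial_cylinder B x n \<subseteq> U" and x: "x \<in> paths B" by blast
    have "path_cylinder B (map x [0..<Suc n]) \<in> path_cylinder B ` finite_paths B"
      using x by (intro imageI initial_list_in_finite_paths) auto
    then have "openin (path_topology B) (path_cylinder B (map x [0..<Suc n]))"
      unfolding path_topology_def by (rule topology_generated_by_Basis)
    then have "openin (path_topology B) (initial_cylinder B x (Suc n))"
      unfolding path_cylinder_initial_list .
    moreover have "initial_cylinder B x (Suc n) \<subseteq> U"
      using n initial_cylinder_antimono[of n "Suc n" B x] by auto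
    ultimately show "\<exists>T. openin (path_topology B) T \<and> x \<in> T \<and> T \<subseteq> U"
      using initial_cylinder_self[OF x] by blast
  qed
qed

lemma openin_initial_cylinder: "openin (path_topology B) (initial_cylinder B x n)"
  unfolding openin_path_topology_iff
proof (intro conjI ballI exI initial_cylinder_subset_paths)
  show "initial_cylinder B y n \<subseteq> initial_cylinder B x n" if "y \<in> initial_cylinder B x n" for y
    by (rule equalityD1[OF initial_cylinder_cong[OF that]])
qed

lemma invariant_iff_initial_cylinder:
  "invariant B M \<longleftrightarrow>
     (\<forall>x\<in>paths B. \<forall>y\<in>paths B. \<forall>n. rng B (x n) = rng B (y n) \<longrightarrow>
        measure M (initial_cylinder B x (Suc n)) = measure M (initial_cylinder B y (Suc n)))"
    (is "_ \<longleftrightarrow> ?R")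
proof
  assume inv: "invariant B M"
  show ?R
  proof (intro ballI allI impI)
    fix x y n assume *: "x \<in> paths B" "y \<in> paths B" "rng B (x n) = rng B (y n)"
    have fin: "map x [0..<Suc n] \<in> finite_paths B" "map y [0..<Suc n] \<in> finite_paths B"
      using *(1,2) by (intro initial_list_in_finite_paths; simp)+
    have "length (map x [0..<Suc n]) = length (map y [0..<Suc n]) \<and>
        rng B (last (map x [0..<Suc n])) = rng B (last (map y [0..<Suc n]))"
      using *(3) by simp
    with inv fin have "measure M (path_cylinder B (map x [0..<Suc n])) = measure M (path_cylinder B (map y [0..<Suc n]))"
      unfolding invariant_def by blast
    then show "measure M (initial_cylinder B x (Suc n)) = measure M (initial_cylinder B y (Suc n))"
      unfolding path_cylinder_initial_list .
  qed
next
  assume R: ?R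
  show "invariant B M"
    unfolding invariant_def
  proof (intro ballI impI)
    fix es fs assume es: "es \<in> finite_paths B" and fs: "fs \<in> finite_paths B"
      and eq: "length es = length fs \<and> rng B (last es) = rng B (last fs)"
    obtain x where x: "x \<in> paths B" "\<forall>i<length es. x i = es ! i"
        "path_cylinder B es = initial_cylinder B x (length es)"
      using path_cylinder_eq_initial_cylinder[OF es] by blast
    obtain y where y: "y \<in> paths B" "\<forall>i<length fs. y i = fs ! i"
        "path_cylinder B fs = initial_cylinder B y (length fs)"
      using path_cylinder_eq_initial_cylinder[OF fs] by blast
    have ne: "es \<noteq> []" "fs \<noteq> []" using es fs by (auto simp: finite_paths_def)
    then obtain n where n: "length es = Suc n" by (cases es) auto
    have "last es = x n" "last fs = y n"
      using x(2) y(2) n ne eq by (auto simp: last_conv_nth dest!: arg_cong[where f = "\<lambda>k. k - 1"])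
    then have "rng B (x n) = rng B (y n)"
      using eq by simp
    then have "measure M (initial_cylinder B x (Suc n)) = measure M (initial_cylinder B y (Suc n))"
      using R x(1) y(1) by blast
    then show "measure M (path_cylinder B es) = measure M (path_cylinder B fs)"
      using x(3) y(3) n eq by simp
  qed
qed

lemma finite_initial_segments: "finite (initial_segment n ` paths B)"
proof (rule finite_subset)
  show "initial_segment n ` paths B \<subseteq> Pi\<^sub>E {..<n} (edges B)"
    by (intro image_subsetI) (simp add: initial_segment_def restrict_PiE_iff path_edge)
  show "finite (Pi\<^sub>E {..<n} (edges B))"
    by (intro finite_PiE finite_edges) auto
qed

lemma finite_initial_cylinders: "finite ((\<lambda>x. initial_cylinder B x n) ` paths B)"
proof -
  have "(\<lambda>x. initial_cylinder B x n) ` paths B =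
      (\<lambda>s. {y \<in> paths B. initial_segment n y = s}) ` initial_segment n ` paths B"
    by (simp add: image_image initial_cylinder_eq_segment)
  then show ?thesis using finite_initial_segments by simp
qed

text \<open>Replacing the first \<open>n\<close> edges of one path by those of another is possible as soon as the \<open>n\<close>-th
  edges have the same range; hence the number of continuations depends only on that range.\<close>

lemma card_continuations_le:
  assumes "x \<in> paths B" "y \<in> paths B" "rng B (x n) = rng B (y n)" "Suc n \<le> m"
  shows "card (initial_segment m ` initial_cylinder B y (Suc n))
       \<le> card (initial_segment m ` initial_cylinder B x (Suc n))"
proof -
  let ?h = "\<lambda>f. initial_segment m (splice (Suc n) y f)"
  have "initial_segment m z \<in> ?h ` (initial_segment m ` initial_cylinder B x (Suc n))"
    if z: "z \<in> initial_cylinder B y (Suc n)" for z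
  proof
    have z': "z \<in> paths B" "z n = y n" using z by (auto simp: initial_cylinder_def)
    have "rng B (x n) = src B (z (Suc n))"
      using assms(3) path_composable[OF z'(1), of n] z'(2) by simp
    then have "splice (Suc n) x z \<in> paths B"
      using assms(1) z' by (intro splice_in_paths) auto
    then have "splice (Suc n) x z \<in> initial_cylinder B x (Suc n)"
      by (auto simp: initial_cylinder_def splice_def)
    then show "initial_segment m (splice (Suc n) x z) \<in> initial_segment m ` initial_cylinder B x (Suc n)"
      by (rule imageI)
    show "initial_segment m z = ?h (initial_segment m (splice (Suc n) x z))"
      using z by (auto simp: initial_segment_def splice_def restrict_def fun_eq_iff initial_cylinder_def)
  qed
  then have "initial_segment m ` initial_cylinder B y (Suc n)
      \<subseteq> ?h ` (initial_segment m ` initial_cylinder B x (Suc n))"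
    by blast
  moreover have "finite (initial_segment m ` initial_cylinder B x (Suc n))"
    by (rule finite_subset[OF image_mono[OF initial_cylinder_subset_paths] finite_initial_segments])
  ultimately show ?thesis by (rule surj_card_le[rotated])
qed

lemma card_continuations_eq:
  assumes "x \<in> paths B" "y \<in> paths B" "rng B (x n) = rng B (y n)" "Suc n \<le> m"
  shows "card (initial_segment m ` initial_cylinder B x (Suc n))
       = card (initial_segment m ` initial_cylinder B y (Suc n))"
  using card_continuations_le[OF assms] card_continuations_le[OF assms(2,1) assms(3)[symmetric] assms(4)]
  by simp

lemma initial_cylinder_in_sets:
  assumes "borel_prob_measure B M"
  shows "initial_cylinder B x n \<in> sets M"
  using assms openin_initial_cylinder by (simp add: borel_prob_measure_def)

text \<open>A cylinder is the disjoint union of its continuations: if all cylinders of length \<open>m\<close> have the same mass, the mass of a shorter cylinder is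
  obtained by counting its continuations to length \<open>m\<close>.\<close>

lemma measure_initial_cylinder_count:
  fixes c :: real
  assumes M: "borel_prob_measure B M" and "n \<le> m"
    and c: "\<And>y. y \<in> paths B \<Longrightarrow> measure M (initial_cylinder B y m) = c"
  shows "measure M (initial_cylinder B x n) = card (initial_segment m ` initial_cylinder B x n) * c"
proof -
  interpret prob_space M using M by (simp add: borel_prob_measure_def)
  let ?S = "initial_segment m ` initial_cylinder B x n"
  let ?A = "\<lambda>s. {y \<in> paths B. initial_segment m y = s}"
  have A: "\<exists>y\<in>paths B. ?A s = initial_cylinder B y m" if "s \<in> ?S" for s
    using that initial_cylinder_subset_paths by (fastforce simp: initial_cylinder_eq_segment)
  have "initial_cylinder B x n = (\<Union>s\<in>?S. ?A s)"
  proof (intro equalityI subsetI)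
    fix y assume "y \<in> (\<Union>s\<in>?S. ?A s)"
    then obtain z where "z \<in> initial_cylinder B x n" "y \<in> initial_cylinder B z m"
      by (auto simp: initial_cylinder_eq_segment)
    then show "y \<in> initial_cylinder B x n"
      using \<open>n \<le> m\<close> by (auto simp: initial_cylinder_def)
  qed (auto simp: initial_cylinder_def)
  then have "measure M (initial_cylinder B x n) = measure M (\<Union>s\<in>?S. ?A s)"
    by (rule arg_cong)
  also have "\<dots> = (\<Sum>s\<in>?S. measure M (?A s))"
  proof (rule finite_measure_finite_Union)
    show "finite ?S"
      by (rule finite_subset[OF image_mono[OF initial_cylinder_subset_paths] finite_initial_segments])
    show "?A ` ?S \<subseteq> sets M"
      using A initial_cylinder_in_sets[OF M] by (metis (no_types, lifting) image_subsetI)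
    show "disjoint_family_on ?A ?S" by (auto simp: disjoint_family_on_def)
  qed
  also have "\<dots> = (\<Sum>s\<in>?S. c)"
  proof (rule sum.cong)
    fix s assume "s \<in> ?S"
    then show "measure M (?A s) = c" using A[of s] c by metis
  qed simp
  finally show ?thesis by simp
qed

text \<open>A path with a parallel edge at infinitely many places can be altered at any single one of
  them without leaving its tail class.\<close>

lemma no_periodic_component_if_parallel_edges:
  assumes "infinite {k. \<forall>e\<in>edges B k. \<exists>e'\<in>edges B k. e' \<noteq> e \<and> rng B e' = rng B e \<and> src B e' = src B e}"
    (is "infinite ?K")
  shows "\<not> periodic_component B P"
proof
  assume "periodic_component B P"
  then obtain x where x: "x \<in> paths B" and fin: "finite (tail_class B x)"
    by (auto simp: periodic_component_def)
  have "\<forall>k\<in>?K. \<exists>e'. e' \<in> edges B k \<and> e' \<noteq> x k \<and> rng B e' = rng B (x k) \<and> src B e' = src B (x k)"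
    using path_edge[OF x] by blast
  from bchoice[OF this] obtain f where "\<forall>k\<in>?K. f k \<in> edges B k \<and> f k \<noteq> x k \<and>
      rng B (f k) = rng B (x k) \<and> src B (f k) = src B (x k)" ..
  then have f: "f k \<in> edges B k \<and> f k \<noteq> x k \<and> rng B (f k) = rng B (x k) \<and> src B (f k) = src B (x k)"
    if "k \<in> ?K" for k
    using that by blast
  have "x(k := f k) \<in> tail_class B x" if "k \<in> ?K" for k
  proof -
    have "x(k := f k) \<in> paths B"
      using x f[OF that] by (auto simp: paths_def)
    moreover have "\<forall>n\<ge>Suc k. (x(k := f k)) n = x n" by simp
    ultimately show ?thesis
      unfolding tail_class_def by blast
  qed
  then have "(\<lambda>k. x(k := f k)) ` ?K \<subseteq> tail_class B x" by blast
  moreover have "inj_on (\<lambda>k. x(k := f k)) ?K"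
  proof (rule inj_onI)
    fix k l assume k: "k \<in> ?K" and eq: "x(k := f k) = x(l := f l)"
    show "k = l"
    proof (rule ccontr)
      assume "k \<noteq> l"
      then show False using f[OF k] fun_cong[OF eq, of k] by simp
    qed
  qed
  ultimately show False
    using fin assms by (meson finite_imageD finite_subset)
qed

end

section \<open>Diagrams with infinitely many bottlenecks\<close>

locale bottleneck_diagram = bratteli_diagram_locale +
  assumes infinitely_many_bottlenecks: "infinite {k. is_singleton (verts B k)}"
begin

text \<open>Level \<open>0\<close> is included so that the bottlenecks cut every path completely into segments; no
  edge ends there, so there is nothing to be glued at it.\<close>

definition bottleneck :: "nat \<Rightarrow> bool" where
  "bottleneck k \<longleftrightarrow> k = 0 \<or> is_singleton (verts B k)"

lemma bottleneck_0 [simp]: "bottleneck 0"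
  by (simp add: bottleneck_def)

lemma bottleneck_beyond: "\<exists>m>n. bottleneck m"
  using infinitely_many_bottlenecks by (auto simp: bottleneck_def infinite_nat_iff_unbounded)

lemma bottleneck_rng_eq:
  assumes "bottleneck (Suc k)" "x \<in> paths B" "y \<in> paths B"
  shows "rng B (x k) = rng B (y k)"
proof -
  obtain v where "verts B (Suc k) = {v}"
    using assms(1) by (auto simp: bottleneck_def elim: is_singletonE)
  then show ?thesis
    using rng_in_verts[OF path_edge[OF assms(2)], of k] rng_in_verts[OF path_edge[OF assms(3)], of k] by simp
qed

lemma bottleneck_splice:
  assumes "bottleneck n" "x \<in> paths B" "y \<in> paths B"
  shows "splice n x y \<in> paths B"
proof (rule splice_in_paths[OF assms(2,3)])
  fix k assume "n = Suc k"
  then show "rng B (x k) = src B (y n)"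
    using bottleneck_rng_eq[of k x y] assms path_composable[of y k] by simp
qed

lemma transitive: "transitive B"
proof -
  obtain x where x: "x \<in> paths B" using paths_nonempty by blast
  have "tail_class B x \<inter> U \<noteq> {}" if U: "openin (path_topology B) U" "U \<noteq> {}" for U
  proof -
    obtain y where "y \<in> U" using U by blast
    with U obtain n where y: "y \<in> paths B" and n: "initial_cylinder B y n \<subseteq> U"
      unfolding openin_path_topology_iff by blast
    obtain m where m: "m > n" "bottleneck m" using bottleneck_beyond by blast
    have z: "splice m y x \<in> paths B" by (rule bottleneck_splice[OF m(2) y x])
    then have "splice m y x \<in> initial_cylinder B y n"
      using m by (simp add: initial_cylinder_def splice_def)
    moreover have "splice m y x \<in> tail_class B x"
      using z by (auto simp: tail_class_def splice_def intro!: exI[of _ m])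
    ultimately show ?thesis using n by blast
  qed
  then have "path_topology B closure_of tail_class B x = topspace (path_topology B)"
    unfolding dense_intersects_open by blast
  then show ?thesis
    using x by (auto simp: transitive_def topspace_path_topology)
qed

text \<open>Cylinders that end at bottlenecks already generate the Borel sets, and nested or disjoint as
  they are, they form a \<open>\<pi>\<close>-system once the empty set is added.\<close>

definition bottleneck_cylinders :: "(nat \<Rightarrow> 'b) set set" where
  "bottleneck_cylinders = insert {} {initial_cylinder B x n | x n. x \<in> paths B \<and> bottleneck n}"

lemma bottleneck_cylinders_subset: "bottleneck_cylinders \<subseteq> Pow (paths B)"
  using initial_cylinder_subset_paths by (auto simp: bottleneck_cylinders_def)

lemma countable_bottleneck_cylinders: "countable bottleneck_cylinders"
proof (rule countable_subset)
  show "bottleneck_cylinders \<subseteq> insert {} (\<Union>n. (\<lambda>x. initial_cylinder B x n) ` paths B)"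
    by (auto simp: bottleneck_cylinders_def)
  have "countable ((\<lambda>x. initial_cylinder B x n) ` paths B)" for n
    by (rule countable_finite[OF finite_initial_cylinders])
  then show "countable (insert {} (\<Union>n. (\<lambda>x. initial_cylinder B x n) ` paths B))"
    by simp
qed

lemma Int_stable_bottleneck_cylinders: "Int_stable bottleneck_cylinders"
proof -
  have nested: "initial_cylinder B x n \<inter> initial_cylinder B y m \<in> {{}, initial_cylinder B y m}"
    if "n \<le> m" for x y n m
    using that by (auto simp: initial_cylinder_def)
  have "initial_cylinder B x n \<inter> initial_cylinder B y m \<in>
      {{}, initial_cylinder B x n, initial_cylinder B y m}" for x y n m
    using nested[of n m x y] nested[of m n y x] by (cases "n \<le> m") (auto simp: Int_commute)
  then show ?thesis
    unfolding Int_stable_def bottleneck_cylinders_def by blast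
qed

lemma sigma_sets_bottleneck_cylinders:
  "sigma_sets (paths B) {U. openin (path_topology B) U} = sigma_sets (paths B) bottleneck_cylinders"
proof (rule sigma_sets_eqI)
  fix U assume "U \<in> {U. openin (path_topology B) U}"
  then have U: "U \<subseteq> paths B" "\<And>x. x \<in> U \<Longrightarrow> \<exists>n. initial_cylinder B x n \<subseteq> U"
    by (auto simp: openin_path_topology_iff)
  have "\<exists>C\<in>bottleneck_cylinders. x \<in> C \<and> C \<subseteq> U" if "x \<in> U" for x
  proof -
    obtain n where n: "initial_cylinder B x n \<subseteq> U" using U(2) \<open>x \<in> U\<close> by blast
    obtain m where m: "m > n" "bottleneck m" using bottleneck_beyond by blast
    have "initial_cylinder B x m \<subseteq> U"
      using n initial_cylinder_antimono[of n m B x] m by auto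
    moreover have "x \<in> paths B" using U(1) that by blast
    ultimately show ?thesis
      using m initial_cylinder_self[of x B m] by (auto simp: bottleneck_cylinders_def)
  qed
  then have "U = \<Union>{C \<in> bottleneck_cylinders. C \<subseteq> U}" by blast
  moreover have "countable {C \<in> bottleneck_cylinders. C \<subseteq> U}"
    using countable_bottleneck_cylinders by simp
  ultimately show "U \<in> sigma_sets (paths B) bottleneck_cylinders"
    using sigma_algebra.countable_Union[OF sigma_algebra_sigma_sets[OF bottleneck_cylinders_subset],
        of "{C \<in> bottleneck_cylinders. C \<subseteq> U}"]
    by (auto intro: sigma_sets.Basic)
next
  fix C assume "C \<in> bottleneck_cylinders"
  then have "openin (path_topology B) C"
    using openin_initial_cylinder by (auto simp: bottleneck_cylinders_def)
  then show "C \<in> sigma_sets (paths B) {U. openin (path_topology B) U}"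
    by (intro sigma_sets.Basic) simp
qed

text \<open>All cylinders that end at one bottleneck have equal mass by invariance, and they partition the
  path space.\<close>

lemma measure_bottleneck_cylinder:
  assumes M: "borel_prob_measure B M" and inv: "invariant B M"
    and x: "x \<in> paths B" and n: "bottleneck n"
  shows "measure M (initial_cylinder B x n) = 1 / card (initial_segment n ` paths B)"
proof -
  interpret prob_space M using M by (simp add: borel_prob_measure_def)
  let ?c = "measure M (initial_cylinder B x n)"
  have c: "measure M (initial_cylinder B y n) = ?c" if "y \<in> paths B" for y
  proof (cases n)
    case (Suc k)
    then show ?thesis
      using inv bottleneck_rng_eq[of k y x] n x that unfolding invariant_iff_initial_cylinder by metis
  qed simp
  have "measure M (initial_cylinder B x 0) = card (initial_segment n ` initial_cylinder B x 0) * ?c"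
    by (rule measure_initial_cylinder_count[OF M _ c]) simp_all
  moreover have "measure M (paths B) = 1"
    using M prob_space by (simp add: borel_prob_measure_def)
  moreover have "card (initial_segment n ` paths B) \<noteq> 0"
    using finite_initial_segments paths_nonempty by simp
  ultimately show ?thesis
    unfolding initial_cylinder_0 by (simp add: eq_divide_eq mult.commute)
qed

lemma invariant_measure_unique:
  assumes M: "borel_prob_measure B M" "invariant B M" and N: "borel_prob_measure B N" "invariant B N"
  shows "M = N"
proof -
  interpret M: prob_space M using M(1) by (simp add: borel_prob_measure_def)
  interpret N: prob_space N using N(1) by (simp add: borel_prob_measure_def)
  have eq: "emeasure M X = emeasure N X" if X: "X \<in> bottleneck_cylinders" for X
  proof (cases "X = {}")
    case False
    then obtain x n where x: "X = initial_cylinder B x n" "x \<in> paths B" "bottleneck n"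
      using X unfolding bottleneck_cylinders_def by blast
    have "measure M X = measure N X"
      unfolding x(1) measure_bottleneck_cylinder[OF M x(2,3)] measure_bottleneck_cylinder[OF N x(2,3)] ..
    then show ?thesis
      unfolding M.emeasure_eq_measure N.emeasure_eq_measure by simp
  qed simp
  have sets: "sets M = sigma_sets (paths B) bottleneck_cylinders"
      "sets N = sigma_sets (paths B) bottleneck_cylinders"
    using M(1) N(1) unfolding borel_prob_measure_def sigma_sets_bottleneck_cylinders by blast+
  obtain x where "x \<in> paths B" using paths_nonempty by blast
  then have "initial_cylinder B x 0 \<in> bottleneck_cylinders"
    unfolding bottleneck_cylinders_def using bottleneck_0 by blast
  then have paths: "range (\<lambda>_::nat. paths B) \<subseteq> bottleneck_cylinders" by simp
  show ?thesis
    by (rule measure_eqI_generator_eq[OF Int_stable_bottleneck_cylinders bottleneck_cylinders_subset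
          eq sets paths]) simp_all
qed

subsection \<open>The path space as a product of finite sets\<close>

definition block_start :: "nat \<Rightarrow> nat" where
  "block_start i = (GREATEST k. k \<le> i \<and> bottleneck k)"

definition block :: "nat \<Rightarrow> nat set" where
  "block k = {i. block_start i = k}"

text \<open>The segments are indexed by all levels rather than by the bottlenecks; a level that is not a
  bottleneck has an empty block and contributes a factor with one point.\<close>

definition block_segments :: "nat \<Rightarrow> (nat \<Rightarrow> 'b) set" where
  "block_segments k = (\<lambda>x. restrict x (block k)) ` paths B"

definition concat_segments :: "(nat \<Rightarrow> nat \<Rightarrow> 'b) \<Rightarrow> nat \<Rightarrow> 'b" where
  "concat_segments \<omega> i = \<omega> (block_start i) i"

lemma block_start_le: "block_start i \<le> i" and bottleneck_block_start: "bottleneck (block_start i)"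
proof -
  have "block_start i \<le> i \<and> bottleneck (block_start i)"
    using GreatestI_nat[of "\<lambda>k. k \<le> i \<and> bottleneck k" 0 i] by (simp add: block_start_def)
  then show "block_start i \<le> i" "bottleneck (block_start i)" by auto
qed

lemma le_block_start: "bottleneck k \<Longrightarrow> k \<le> i \<Longrightarrow> k \<le> block_start i"
  using Greatest_le_nat[of "\<lambda>k. k \<le> i \<and> bottleneck k" k i] by (simp add: block_start_def)

lemma block_start_Suc:
  assumes "block_start (Suc i) \<noteq> Suc i"
  shows "block_start (Suc i) = block_start i"
proof (rule antisym)
  have "block_start (Suc i) \<le> i"
    using assms block_start_le[of "Suc i"] by linarith
  then show "block_start (Suc i) \<le> block_start i"
    by (rule le_block_start[OF bottleneck_block_start])
  show "block_start i \<le> block_start (Suc i)"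
    using block_start_le[of i] by (intro le_block_start bottleneck_block_start) linarith
qed

lemma block_below_bottleneck: "bottleneck m \<Longrightarrow> i \<in> block k \<Longrightarrow> k < m \<longleftrightarrow> i < m"
  unfolding block_def mem_Collect_eq using block_start_le[of i] le_block_start[of m i] by linarith

lemma finite_block: "finite (block k)"
proof -
  obtain m where "m > k" "bottleneck m" using bottleneck_beyond by blast
  then have "block k \<subseteq> {..<m}" using block_below_bottleneck by auto
  then show ?thesis by (rule finite_subset) simp
qed

lemma finite_block_segments: "finite (block_segments k)"
proof (rule finite_subset)
  show "block_segments k \<subseteq> Pi\<^sub>E (block k) (edges B)"
    by (simp add: block_segments_def image_subset_iff restrict_PiE_iff path_edge)
  show "finite (Pi\<^sub>E (block k) (edges B))"
    by (intro finite_PiE finite_edges finite_block)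
qed

lemma block_segments_nonempty: "block_segments k \<noteq> {}"
  using paths_nonempty by (simp add: block_segments_def)

text \<open>Any choice of segments fits together: inside a block the choice is taken from one path, and
  between two blocks there is a single vertex to pass through.\<close>

lemma concat_segments_in_paths:
  assumes "\<And>k. \<omega> k \<in> block_segments k"
  shows "concat_segments \<omega> \<in> paths B"
proof -
  have "\<forall>k. \<exists>x. x \<in> paths B \<and> \<omega> k = restrict x (block k)"
    using assms by (auto simp: block_segments_def)
  then obtain x where x: "\<And>k. x k \<in> paths B" "\<And>k. \<omega> k = restrict (x k) (block k)"
    by metis
  have eq: "concat_segments \<omega> i = x (block_start i) i" for i
    by (simp add: concat_segments_def x(2) block_def)
  have "rng B (concat_segments \<omega> i) = src B (concat_segments \<omega> (Suc i))" for i
  proof (cases "block_start (Suc i) = Suc i")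
    case True
    then have "bottleneck (Suc i)" using bottleneck_block_start[of "Suc i"] by simp
    then have "rng B (x (block_start i) i) = rng B (x (Suc i) i)"
      by (rule bottleneck_rng_eq) (rule x(1))+
    then show ?thesis
      using True path_composable[OF x(1)[of "Suc i"], of i] by (simp add: eq)
  next
    case False
    show ?thesis
      using path_composable[OF x(1)[of "block_start i"], of i] by (simp add: eq block_start_Suc[OF False])
  qed
  then show ?thesis
    using path_edge[OF x(1)] by (simp add: paths_def eq)
qed

lemma concat_segments_agree_iff:
  assumes "bottleneck m" "\<And>k. \<omega> k \<in> extensional (block k)"
  shows "(\<forall>i<m. concat_segments \<omega> i = y i) \<longleftrightarrow> (\<forall>k<m. \<omega> k = restrict y (block k))"
proof
  assume L: "\<forall>i<m. concat_segments \<omega> i = y i"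
  show "\<forall>k<m. \<omega> k = restrict y (block k)"
  proof (intro allI impI)
    fix k assume k: "k < m"
    show "\<omega> k = restrict y (block k)"
    proof (rule extensionalityI[OF assms(2)])
      fix i assume i: "i \<in> block k"
      then have "i < m" using block_below_bottleneck[OF assms(1)] k by blast
      then show "\<omega> k i = restrict y (block k) i"
        using L i by (auto simp: concat_segments_def block_def)
    qed simp
  qed
next
  assume R: "\<forall>k<m. \<omega> k = restrict y (block k)"
  show "\<forall>i<m. concat_segments \<omega> i = y i"
  proof (intro allI impI)
    fix i assume "i < m"
    then have "block_start i < m" using block_start_le[of i] by simp
    then show "concat_segments \<omega> i = y i"
      using R by (simp add: concat_segments_def block_def)
  qed
qed

text \<open>The image of the product of the uniform measures gives equal mass to all cylinders that end at a
  given bottleneck. This is more than invariance at that level, and it implies invariance at every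
  earlier level, because equal ranges have equally many continuations to the next bottleneck.\<close>

lemma invariant_measure_exists: "\<exists>M. borel_prob_measure B M \<and> invariant B M"
proof -
  let ?U = "\<lambda>k. uniform_count_measure (block_segments k)"
  let ?P = "PiM UNIV ?U"
  let ?M = "distr ?P (measure_of (paths B) {U. openin (path_topology B) U} (\<lambda>_. 0)) concat_segments"
  have prob_U: "prob_space (?U k)" for k
    by (rule prob_space_uniform_count_measure[OF finite_block_segments block_segments_nonempty])
  interpret prod: product_prob_space ?U UNIV
    using prob_U by (simp add: product_prob_space_def product_prob_space_axioms_def
        product_sigma_finite_def prob_space_imp_sigma_finite)
  have space_P: "space ?P = {\<omega>. \<forall>k. \<omega> k \<in> block_segments k}"
    by (auto simp: space_PiM space_uniform_count_measure)
  have opens: "{U. openin (path_topology B) U} \<subseteq> Pow (paths B)"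
    using openin_subset[of "path_topology B"] by (auto simp: topspace_path_topology)
  \<comment> \<open>A cylinder that ends at a bottleneck prescribes finitely many whole segments and nothing else.\<close>
  have preimage: "concat_segments -` initial_cylinder B y m \<inter> space ?P =
      prod_emb UNIV ?U {..<m} (Pi\<^sub>E {..<m} (\<lambda>k. {restrict y (block k)}))"
    if m: "bottleneck m" and y: "y \<in> paths B" for y m
  proof -
    have "\<omega> \<in> concat_segments -` initial_cylinder B y m \<longleftrightarrow> (\<forall>k<m. \<omega> k = restrict y (block k))"
      if \<omega>: "\<And>k. \<omega> k \<in> block_segments k" for \<omega>
    proof -
      have "\<omega> k \<in> extensional (block k)" for k
        using \<omega>[of k] by (auto simp: block_segments_def)
      from concat_segments_agree_iff[OF m this, of y] show ?thesis
        using concat_segments_in_paths[OF \<omega>] by (auto simp: initial_cylinder_def)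
    qed
    then show ?thesis
      using space_P by (auto simp: prod_emb_def space_uniform_count_measure PiE_iff)
  qed
  have cyl_sets: "{restrict y (block k)} \<in> sets (?U k)" if "y \<in> paths B" for y k
    using that by (auto simp: sets_uniform_count_measure block_segments_def)
  have meas: "concat_segments \<in> measurable ?P (measure_of (paths B) {U. openin (path_topology B) U} (\<lambda>_. 0))"
  proof (rule measurable_sigma_sets[of _ "paths B" bottleneck_cylinders])
    show "sets (measure_of (paths B) {U. openin (path_topology B) U} (\<lambda>_. 0)) =
        sigma_sets (paths B) bottleneck_cylinders"
      using opens by (simp add: sigma_sets_bottleneck_cylinders)
    show "concat_segments \<in> space ?P \<rightarrow> paths B"
      using concat_segments_in_paths by (auto simp: space_P)
    fix C assume "C \<in> bottleneck_cylinders"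
    then consider "C = {}" | y m where "C = initial_cylinder B y m" "y \<in> paths B" "bottleneck m"
      by (auto simp: bottleneck_cylinders_def)
    then show "concat_segments -` C \<inter> space ?P \<in> sets ?P"
    proof cases
      case 2
      show ?thesis
        unfolding 2(1) preimage[OF 2(3,2)] by (intro sets_PiM_I) (auto simp: cyl_sets[OF 2(2)])
    qed simp
  qed (rule bottleneck_cylinders_subset)
  have borel: "borel_prob_measure B ?M"
    unfolding borel_prob_measure_def
    using prod.P.prob_space_distr[OF meas] opens by simp
  have mass: "measure ?M (initial_cylinder B y m) = (\<Prod>k<m. 1 / card (block_segments k))"
    if m: "bottleneck m" and y: "y \<in> paths B" for y m
  proof -
    have "initial_cylinder B y m \<in> sets (measure_of (paths B) {U. openin (path_topology B) U} (\<lambda>_. 0))"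
      using openin_initial_cylinder opens by simp
    then have "measure ?M (initial_cylinder B y m) = measure ?P (concat_segments -` initial_cylinder B y m \<inter> space ?P)"
      by (rule measure_distr[OF meas])
    also have "\<dots> = (\<Prod>k<m. measure (?U k) {restrict y (block k)})"
      unfolding preimage[OF m y] by (rule prod.measure_PiM_emb) (auto simp: cyl_sets[OF y])
    also have "\<dots> = (\<Prod>k<m. 1 / card (block_segments k))"
    proof (intro prod.cong refl)
      fix k
      have "{restrict y (block k)} \<subseteq> block_segments k"
        using y by (simp add: block_segments_def)
      then show "measure (?U k) {restrict y (block k)} = 1 / card (block_segments k)"
        by (simp add: measure_uniform_count_measure finite_block_segments)
    qed
    finally show ?thesis .
  qed
  have "invariant B ?M"
    unfolding invariant_iff_initial_cylinder
  proof (intro ballI allI impI)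
    fix x y n assume xy: "x \<in> paths B" "y \<in> paths B" "rng B (x n) = rng B (y n)"
    obtain m where m: "m > n" "bottleneck m" using bottleneck_beyond by blast
    then have le: "Suc n \<le> m" by simp
    show "measure ?M (initial_cylinder B x (Suc n)) = measure ?M (initial_cylinder B y (Suc n))"
      using measure_initial_cylinder_count[OF borel le mass[OF m(2)]] card_continuations_eq[OF xy le]
      by simp
  qed
  with borel show ?thesis by blast
qed

lemma uniquely_ergodic: "uniquely_ergodic B"
  unfolding uniquely_ergodic_def
  using invariant_measure_exists invariant_measure_unique by blast

end

section \<open>Generic matrix sequences\<close>

text \<open>One vertex on each side, joined by two parallel edges.\<close>

definition doubling_matrix :: "nat mat" where
  "doubling_matrix = mat 1 1 (\<lambda>_. 2)"

definition doubling_beyond :: "nat \<Rightarrow> (int \<Rightarrow> nat mat) set" where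
  "doubling_beyond n = {F \<in> beth. \<exists>k>n. F (int k) = doubling_matrix}"

lemma positive_part_minimal_uniquely_ergodic:
  assumes F: "F \<in> beth" and doubling: "\<And>n. F \<in> doubling_beyond n"
  shows "minimal (positive_part F) \<and> uniquely_ergodic (positive_part F)"
proof -
  let ?B = "positive_part F" and ?K = "{k. F (int k + 1) = doubling_matrix}"
  have inf: "infinite ?K"
    unfolding infinite_nat_iff_unbounded
  proof
    fix n
    obtain k where k: "k > Suc n" "F (int k) = doubling_matrix"
      using doubling[of "Suc n"] by (auto simp: doubling_beyond_def)
    then have "k - 1 > n" "int (k - 1) + 1 = int k" by auto
    with k(2) show "\<exists>j>n. j \<in> ?K" by auto
  qed
  interpret bratteli_diagram_locale ?B
    by unfold_locales (rule bratteli_diagram_positive_part[OF F])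
  have "verts ?B k = {(k, 0)}" if "k \<in> ?K" for k
    using that by (auto simp: positive_part_def diagram_of_def doubling_matrix_def)
  then have "?K \<subseteq> {k. is_singleton (verts ?B k)}"
    by (auto simp: is_singleton_def)
  then interpret bottleneck_diagram ?B
    using inf by unfold_locales (rule infinite_super)
  have "?K \<subseteq> {k. \<forall>e\<in>edges ?B k. \<exists>e'\<in>edges ?B k. e' \<noteq> e \<and> rng ?B e' = rng ?B e \<and> src ?B e' = src ?B e}"
  proof
    fix k assume "k \<in> ?K"
    then have E: "edges ?B k = {(k, 0, 0, 0), (k, 0, 0, 1)}"
      by (auto simp: positive_part_def diagram_of_def doubling_matrix_def)
    show "k \<in> {k. \<forall>e\<in>edges ?B k. \<exists>e'\<in>edges ?B k. e' \<noteq> e \<and> rng ?B e' = rng ?B e \<and> src ?B e' = src ?B e}"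
      by (auto simp: E) (auto simp: positive_part_def diagram_of_def)
  qed
  then have "infinite {k. \<forall>e\<in>edges ?B k. \<exists>e'\<in>edges ?B k. e' \<noteq> e \<and> rng ?B e' = rng ?B e \<and> src ?B e' = src ?B e}"
    using inf by (rule infinite_super)
  then have "\<not> (\<exists>P. periodic_component ?B P)"
    using no_periodic_component_if_parallel_edges by blast
  then show ?thesis
    using transitive uniquely_ergodic by (simp add: minimal_def)
qed

lemma openin_beth_topology_window:
  assumes "openin beth_topology U" "F \<in> U"
  shows "\<exists>I. finite I \<and> beth_cylinder I F \<subseteq> U"
proof -
  have "generate_topology_on {beth_cylinder I A | I A. finite I \<and> 0 \<notin> I} U"
    using assms(1) by (simp add: beth_topology_def openin_topology_generated_by)
  then show ?thesis
    using assms(2)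
  proof induction
    case Empty
    then show ?case by simp
  next
    case (Int a b)
    then obtain I J where IJ: "finite I" "beth_cylinder I F \<subseteq> a" "finite J" "beth_cylinder J F \<subseteq> b" by blast
    then have "finite (I \<union> J) \<and> beth_cylinder (I \<union> J) F \<subseteq> a \<inter> b"
      by (auto simp: beth_cylinder_def)
    then show ?case ..
  next
    case (UN K)
    then show ?case by (meson Union_iff Sup_upper subset_trans)
  next
    case (Basis s)
    then obtain I A where "s = beth_cylinder I A" "finite I" by blast
    then have "beth_cylinder I F \<subseteq> s" using Basis by (auto simp: beth_cylinder_def)
    with \<open>finite I\<close> show ?case by blast
  qed
qed

lemma openin_doubling_beyond: "openin beth_topology (doubling_beyond n)"
proof -
  have "doubling_beyond n = (\<Union>k\<in>{n<..}. beth_cylinder {int k} (\<lambda>_. doubling_matrix))"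
    by (auto simp: doubling_beyond_def beth_cylinder_def)
  moreover have "openin beth_topology (beth_cylinder {int k} (\<lambda>_. doubling_matrix))" if "k > n" for k
    unfolding beth_topology_def by (rule topology_generated_by_Basis) (use that in force)
  ultimately show ?thesis by auto
qed

text \<open>The one-row matrix of ones collapses the level reached after the prescribed window to a single
  vertex, after which the doubling matrix can be repeated for ever.\<close>

lemma doubling_prolongation_in_beth:
  assumes F: "F \<in> beth" and m: "m > 0"
  shows "(\<lambda>k. if k \<le> m then F k else if k = m + 1 then mat 1 (dim_row (F m)) (\<lambda>_. 1)
              else doubling_matrix) \<in> beth" (is "?G \<in> beth")
proof -
  have T: "transition_matrix (F k)" if "k \<noteq> 0" for k
    using F that by (simp add: beth_def)
  have D: "dim_row (F k) = dim_col (F (k + 1))" if "k \<noteq> 0" "k \<noteq> - 1" for k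
    using F that unfolding beth_def by blast
  have D1: "dim_row (F (- 1)) = dim_col (F 1)" and ext: "F \<in> extensional (- {0})"
    using F by (simp_all add: beth_def)
  have pos: "0 < dim_row (F m)" using T[of m] m by (simp add: transition_matrix_def)
  have "transition_matrix (?G k)" if "k \<noteq> 0" for k
    using T[OF that] pos by (auto simp: transition_matrix_def doubling_matrix_def)
  moreover have "dim_row (?G k) = dim_col (?G (k + 1))" if "k \<noteq> 0" "k \<noteq> - 1" for k
  proof -
    consider "k + 1 \<le> m" | "k = m" | "k > m" by linarith
    then show ?thesis
      using D[OF that] by cases (auto simp: doubling_matrix_def)
  qed
  moreover have "dim_row (?G (- 1)) = dim_col (?G 1)"
    using D1 m by simp
  moreover have "?G \<in> extensional (- {0})"
    using ext m by (auto simp: extensional_def)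
  ultimately show ?thesis
    unfolding beth_def by blast
qed

lemma dense_doubling_beyond: "beth_topology closure_of doubling_beyond n = topspace beth_topology"
  unfolding dense_intersects_open
proof (intro allI impI, elim conjE)
  fix U assume U: "openin beth_topology U" "U \<noteq> {}"
  then obtain F where FU: "F \<in> U" by blast
  then have F: "F \<in> beth"
    using openin_subset[OF U(1)] by (auto simp: topspace_beth_topology)
  obtain I where I: "finite I" "beth_cylinder I F \<subseteq> U"
    using openin_beth_topology_window[OF U(1) FU] by blast
  define m where "m = Max (insert (int n + 1) I)"
  have m: "int n + 1 \<le> m" "\<And>k. k \<in> I \<Longrightarrow> k \<le> m"
    using I(1) by (auto simp: m_def)
  define G where "G = (\<lambda>k. if k \<le> m then F k else if k = m + 1 then mat 1 (dim_row (F m)) (\<lambda>_. 1)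
              else doubling_matrix)"
  have G: "G \<in> beth"
    unfolding G_def using m by (intro doubling_prolongation_in_beth[OF F]) simp
  then have "G \<in> beth_cylinder I F"
    using m(2) by (simp add: beth_cylinder_def G_def)
  moreover have "G \<in> doubling_beyond n"
    using G m(1) by (auto simp: doubling_beyond_def G_def intro!: exI[of _ "nat (m + 2)"])
  ultimately show "doubling_beyond n \<inter> U \<noteq> {}"
    using I(2) by blast
qed

theorem proposition1:
  "residual_in beth_topology
     {F \<in> beth. minimal (positive_part F) \<and> uniquely_ergodic (positive_part F)}"
  unfolding residual_in_def topspace_beth_topology
proof (intro conjI exI[of _ "range doubling_beyond"])
  show "\<forall>U\<in>range doubling_beyond. openin beth_topology U \<and> beth_topology closure_of U = beth"
    using openin_doubling_beyond dense_doubling_beyond by (auto simp: topspace_beth_topology)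
  show "beth \<inter> \<Inter>(range doubling_beyond)
      \<subseteq> {F \<in> beth. minimal (positive_part F) \<and> uniquely_ergodic (positive_part F)}"
    using positive_part_minimal_uniquely_ergodic by blast
qed auto

end
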